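(* Let $N=(G,S,\mathrm{init},F,\oplus)$ be a network instance, where $G=(V,E)$ is a directed graph with finite node set $V$ and edge set $E\subseteq V\times V$, $S$ is a set of routes, $\mathrm{init}:V\to S$, $F$ assigns to each edge $e\in E$ a function $f_e:S\to S$, and $\oplus:S\times S\to S$ is associative and commutative. Define the simulation state $\sigma:V\to(\mathbb{N}\to S)$ by $\sigma(v)(0)=\mathrm{init}(v)$ and $\sigma(v)(t+1)=\mathrm{init}(v)\oplus\bigoplus_{u:\,uv\in E} f_{uv}(\sigma(u)(t))$. Let $A:V\to(\mathbb{N}\to 2^S)$ satisfy, for every node $v\in V$ with in-neighbors $u_1,\dots,u_n$: (initial condition) $\mathrm{init}(v)\in A(v)(0)$; and (inductive condition) for all $t\in\mathbb{N}$ and all $s_1\in A(u_1)(t),\dots,s_n\in A(u_n)(t)$, we have $\mathrm{init}(v)\oplus\bigoplus_{i=1}^n f_{u_iv}(s_i)\in A(v)(t+1)$. Then for all $v\in V$ and all $t\in\mathbb{N}$, $\sigma(v)(t)\in A(v)(t)$.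
   Context: The in-neighbors of $v$ are the nodes $u$ with $uv\in E$. $\bigoplus$ denotes iterated application of the associative and commutative operation $\oplus$. *)

theory Defs
  imports "HOL-Library.FuncSet"
begin

record ('v, 'r) network =
  nodes :: "'v set"
  edges :: "('v \<times> 'v) set"
  routes :: "'r set"
  init :: "'v \<Rightarrow> 'r"
  edge_fun :: "'v \<times> 'v \<Rightarrow> 'r \<Rightarrow> 'r"
  merge :: "'r \<Rightarrow> 'r \<Rightarrow> 'r" (infixl "\<oplus>\<index>" 65)

text \<open>The laws of \<open>\<oplus>\<close> are only required on the set of routes; nothing is assumed about
  values of the components outside their intended domains.\<close>

locale network_instance =
  fixes N :: "('v, 'r) network" (structure)
  assumes finite_nodes: "finite (nodes N)"
    and edges_subset: "edges N \<subseteq> nodes N \<times> nodes N"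
    and init_routes: "init N \<in> nodes N \<rightarrow> routes N"
    and edge_fun_routes: "edge_fun N \<in> edges N \<rightarrow> routes N \<rightarrow> routes N"
    and merge_closed: "\<And>a b. \<lbrakk>a \<in> routes N; b \<in> routes N\<rbrakk> \<Longrightarrow> a \<oplus> b \<in> routes N"
    and merge_assoc: "\<And>a b c. \<lbrakk>a \<in> routes N; b \<in> routes N; c \<in> routes N\<rbrakk>
          \<Longrightarrow> (a \<oplus> b) \<oplus> c = a \<oplus> (b \<oplus> c)"
    and merge_commute: "\<And>a b. \<lbrakk>a \<in> routes N; b \<in> routes N\<rbrakk> \<Longrightarrow> a \<oplus> b = b \<oplus> a"

definition in_neighbors :: "('v, 'r) network \<Rightarrow> 'v \<Rightarrow> 'v set" where
  "in_neighbors N v = {u. (u, v) \<in> edges N}"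

text \<open>\<open>merge_over N a g U\<close> is \<open>a \<oplus> (\<Oplus>u\<in>U. g u)\<close> for finite \<open>U\<close>. There is no neutral element,
  so the iterated operation starts from \<open>a\<close>; for empty \<open>U\<close> the result is \<open>a\<close>.
  The lemmas below show that the value is independent of the order of iteration.\<close>

definition merge_over :: "('v, 'r) network \<Rightarrow> 'r \<Rightarrow> ('v \<Rightarrow> 'r) \<Rightarrow> 'v set \<Rightarrow> 'r" where
  "merge_over N a g U = Finite_Set.fold (\<lambda>u b. b \<oplus>\<^bsub>N\<^esub> g u) a U"

primrec simulation :: "('v, 'r) network \<Rightarrow> 'v \<Rightarrow> nat \<Rightarrow> 'r" where
  "simulation N v 0 = init N v"
| "simulation N v (Suc t) =
     merge_over N (init N v) (\<lambda>u. edge_fun N (u, v) (simulation N u t)) (in_neighbors N v)"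

lemma merge_over_empty: "merge_over N a g {} = a"
  by (simp add: merge_over_def)

context network_instance
begin

lemma merge_over_insert:
  assumes "finite U" and "u \<notin> U" and a: "a \<in> routes N"
    and g: "\<And>w. w \<in> insert u U \<Longrightarrow> g w \<in> routes N"
  shows "merge_over N a g (insert u U) = merge_over N a g U \<oplus> g u"
    and "merge_over N a g U \<in> routes N"
proof -
  define h where "h w b = (if w \<in> insert u U \<and> b \<in> routes N then b \<oplus> g w else b)" for w b
  interpret comp_fun_commute h
  proof
    fix x y
    have "h y (h x b) = h x (h y b)" for b
    proof (cases "x \<in> insert u U \<and> y \<in> insert u U \<and> b \<in> routes N")
      case True
      then have r: "g x \<in> routes N" "g y \<in> routes N" "b \<in> routes N" using g by blast+
      have "(b \<oplus> g x) \<oplus> g y = b \<oplus> (g x \<oplus> g y)" using r by (intro merge_assoc)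
      also have "\<dots> = b \<oplus> (g y \<oplus> g x)" using merge_commute[OF r(1,2)] by (rule arg_cong)
      also have "\<dots> = (b \<oplus> g y) \<oplus> g x" using r by (intro merge_assoc[symmetric])
      finally have "(b \<oplus> g x) \<oplus> g y = (b \<oplus> g y) \<oplus> g x" .
      moreover have "b \<oplus> g x \<in> routes N" "b \<oplus> g y \<in> routes N" using r by (auto intro: merge_closed)
      ultimately show ?thesis using True r unfolding h_def by presburger
    next
      case False
      then show ?thesis unfolding h_def by presburger
    qed
    then show "h y \<circ> h x = h x \<circ> h y" by auto
  qed
  have fold_h: "merge_over N a g W = Finite_Set.fold h a W" if "W \<subseteq> insert u U" for W
    unfolding merge_over_def
    by (rule fold_closed_eq[where B = "routes N"])
      (use that g a in \<open>auto simp: h_def merge_closed\<close>)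
  have h_routes: "h w b \<in> routes N" if "b \<in> routes N" for w b
    using that g by (auto simp: h_def merge_closed)
  have "Finite_Set.fold h a W \<in> routes N" if "finite W" for W
    using that by (induction W) (simp_all add: a h_routes)
  then show closed: "merge_over N a g U \<in> routes N"
    using fold_h[of U] \<open>finite U\<close> by (simp add: subset_insertI)
  have "merge_over N a g (insert u U) = h u (merge_over N a g U)"
    using fold_h[of U] fold_h[of "insert u U"] assms(1,2) by (simp add: subset_insertI)
  then show "merge_over N a g (insert u U) = merge_over N a g U \<oplus> g u"
    using closed by (simp add: h_def)
qed

end

end

theory Submission
  imports Defs
begin

text \<open>Induction on time, for all nodes at once. If at time \<open>t\<close> every
  in-neighbor's route lies in its set, these routes are an admissible choice in the inductive
  condition, and the merged route it yields is exactly the next simulation state.\<close>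

theorem theorem1:
  fixes N :: "('v, 'r) network"
    and A :: "'v \<Rightarrow> nat \<Rightarrow> 'r set"
  assumes "network_instance N"
    and "\<And>v t. v \<in> nodes N \<Longrightarrow> A v t \<subseteq> routes N"
    and "\<And>v. v \<in> nodes N \<Longrightarrow> init N v \<in> A v 0"
    and "\<And>v t s. \<lbrakk>v \<in> nodes N; \<And>u. u \<in> in_neighbors N v \<Longrightarrow> s u \<in> A u t\<rbrakk>
          \<Longrightarrow> merge_over N (init N v) (\<lambda>u. edge_fun N (u, v) (s u)) (in_neighbors N v)
                \<in> A v (Suc t)"
  shows "\<forall>v \<in> nodes N. \<forall>t. simulation N v t \<in> A v t"
proof -
  interpret network_instance N by fact
  \<comment> \<open>\<open>t\<close> is now outermost: the step at \<open>v\<close> needs the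
    hypothesis at its in-neighbors.\<close>
  have "\<forall>v \<in> nodes N. simulation N v t \<in> A v t" for t
  proof (induction t)
    case 0
    show ?case using assms(3) by simp
  next
    case (Suc t)
    show ?case
    proof
      fix v assume v: "v \<in> nodes N"
      \<comment> \<open>In-neighbors are nodes by \<open>edges_subset\<close>, so the induction
        hypothesis covers them.\<close>
      have "simulation N u t \<in> A u t" if "u \<in> in_neighbors N v" for u
        using Suc that edges_subset by (auto simp: in_neighbors_def)
      then show "simulation N v (Suc t) \<in> A v (Suc t)"
        \<comment> \<open>With the simulated routes chosen as \<open>s\<close>, the merge is the
          recursion equation for \<open>Suc t\<close>.\<close>
        using assms(4)[OF v, of "\<lambda>u. simulation N u t" t] by simp
    qed
  qed
  then show ?thesis by blast
qed

end
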